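(* Let $\mathbb{I}=(I_1,I_2)\in\mathbb{S}^2$ with $I_1\neq I_2$, let $U_1$ be an open subset of $\mathbb{C}_{I_1}$ and $U_2$ an open subset of $\mathbb{C}_{I_2}$, and write $\mathbb{U}=(U_1,U_2)$. Let $f:U_1\cup U_2\to\mathbb{H}$ be a function such that $f|_{U_1}$ and $f|_{U_2}$ are both holomorphic. Then $f|_{\mathbb{U}^+_s}$ admits a slice regular extension $\widetilde f$ to $\mathbb{U}^{+\Delta}_s$. Moreover, if $W$ is an st-domain with $W\subseteq\mathbb{U}^{+\Delta}_s$ and $W\cap\mathbb{U}^+_s\neq\varnothing$, then $\widetilde f|_W$ is a slice function and it is the unique slice regular extension to $W$ of $f|_{W\cap\mathbb{U}^+_s}$.
   Context: $\mathbb{H}$ denotes the quaternions and $\mathbb{S}=\{q\in\mathbb{H}: q^2=-1\}$. For $I\in\mathbb{S}$, $\mathbb{C}_I=\mathbb{R}+I\mathbb{R}$ and $\mathbb{C}_I^+=\{x+yI: x,y\in\mathbb{R},\ y>0\}$. For $\Omega\subset\mathbb{H}$, $\Omega_I:=\Omega\cap\mathbb{C}_I$. For $U$ open in $\mathbb{C}_I$, $h:U\to\mathbb{H}$ is (left $\mathbb{C}_I$-)holomorphic if it has continuous partial derivatives and $\frac12\left(\frac{\partial}{\partial x}+I\frac{\partial}{\partial y}\right)h(x+yI)=0$ on $U$; here $f|_{U_\lambda}$ is holomorphic in the left $\mathbb{C}_{I_\lambda}$ sense, $\lambda=1,2$. A set $\Omega\subset\mathbb{H}$ is slice-open if $\Omega_I$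 is open in $\mathbb{C}_I$ for every $I\in\mathbb{S}$; slice-open sets form the slice topology on $\mathbb{H}$. An st-domain is a slice-open set that is connected in the slice topology. A function $f:\Omega\to\mathbb{H}$ on a slice-open set is slice regular if $f|_{\Omega_I}$ is left $\mathbb{C}_I$-holomorphic for every $I\in\mathbb{S}$. For $\mathbb{U}=(U_1,U_2)$ as in the claim define $$\mathbb{U}^+_s:=(U_1\cap\mathbb{C}_{I_1}^+)\cup(U_2\cap\mathbb{C}_{I_2}^+)\cup(U_1\cap U_2\cap\mathbb{R}),$$ $$\mathbb{U}^\Delta_s:=\{x+yL:\ L\in\mathbb{S},\ x,y\in\mathbb{R},\ y\ge 0,\ x+yI_1\in U_1,\ x+yI_2\in U_2\},\qquad \mathbb{U}^{+\Delta}_s:=\mathbb{U}^+_s\cup\mathbb{U}^\Delta_s.$$ The set $\mathbb{U}^{+\Delta}_s$ is slice-open. A function $f:\Omega\to\mathbb{H}$ on an arbitrary set $\Omega\subset\mathbb{H}$ is a slice function if there is a function $F:\mathbb{R}^2\to\mathbb{H}^{2\times1}$ such that $f(x+yI)=(1,I)F(x,y)$ for all $x,y\in\mathbb{R}$ with $y\ge0$ and $I\in\mathbb{S}$ with $x+yI\in\Omega$. *)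

theory Defs
  imports "HOL-Analysis.Analysis"
begin

datatype quat = Quat (qRe: real) (qIm1: real) (qIm2: real) (qIm3: real)

lemma quat_eq_iff:
  "p = q \<longleftrightarrow> qRe p = qRe q \<and> qIm1 p = qIm1 q \<and> qIm2 p = qIm2 q \<and> qIm3 p = qIm3 q"
  by (cases p; cases q) simp

instantiation quat :: ab_group_add
begin

definition zero_quat :: quat where "0 = Quat 0 0 0 0"

definition plus_quat :: "quat \<Rightarrow> quat \<Rightarrow> quat" where
  "p + q = Quat (qRe p + qRe q) (qIm1 p + qIm1 q) (qIm2 p + qIm2 q) (qIm3 p + qIm3 q)"

definition uminus_quat :: "quat \<Rightarrow> quat" where
  "- p = Quat (- qRe p) (- qIm1 p) (- qIm2 p) (- qIm3 p)"

definition minus_quat :: "quat \<Rightarrow> quat \<Rightarrow> quat" where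
  "p - q = Quat (qRe p - qRe q) (qIm1 p - qIm1 q) (qIm2 p - qIm2 q) (qIm3 p - qIm3 q)"

instance
  by standard (simp_all add: quat_eq_iff zero_quat_def plus_quat_def uminus_quat_def minus_quat_def)

end

lemma quat_zero_sel [simp]: "qRe 0 = 0" "qIm1 0 = 0" "qIm2 0 = 0" "qIm3 0 = 0"
  by (simp_all add: zero_quat_def)

lemma quat_add_sel [simp]:
  "qRe (p + q) = qRe p + qRe q" "qIm1 (p + q) = qIm1 p + qIm1 q"
  "qIm2 (p + q) = qIm2 p + qIm2 q" "qIm3 (p + q) = qIm3 p + qIm3 q"
  by (simp_all add: plus_quat_def)

lemma quat_uminus_sel [simp]:
  "qRe (- p) = - qRe p" "qIm1 (- p) = - qIm1 p" "qIm2 (- p) = - qIm2 p" "qIm3 (- p) = - qIm3 p"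
  by (simp_all add: uminus_quat_def)

lemma quat_diff_sel [simp]:
  "qRe (p - q) = qRe p - qRe q" "qIm1 (p - q) = qIm1 p - qIm1 q"
  "qIm2 (p - q) = qIm2 p - qIm2 q" "qIm3 (p - q) = qIm3 p - qIm3 q"
  by (simp_all add: minus_quat_def)

instantiation quat :: real_vector
begin

definition scaleR_quat :: "real \<Rightarrow> quat \<Rightarrow> quat" where
  "scaleR r p = Quat (r * qRe p) (r * qIm1 p) (r * qIm2 p) (r * qIm3 p)"

instance
  by standard (simp_all add: quat_eq_iff scaleR_quat_def algebra_simps)

end

lemma quat_scaleR_sel [simp]:
  "qRe (r *\<^sub>R p) = r * qRe p" "qIm1 (r *\<^sub>R p) = r * qIm1 p"
  "qIm2 (r *\<^sub>R p) = r * qIm2 p" "qIm3 (r *\<^sub>R p) = r * qIm3 p"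
  by (simp_all add: scaleR_quat_def)

instantiation quat :: real_algebra_1
begin

definition one_quat :: quat where "1 = Quat 1 0 0 0"

definition times_quat :: "quat \<Rightarrow> quat \<Rightarrow> quat" where
  "p * q = Quat
     (qRe p * qRe q - qIm1 p * qIm1 q - qIm2 p * qIm2 q - qIm3 p * qIm3 q)
     (qRe p * qIm1 q + qIm1 p * qRe q + qIm2 p * qIm3 q - qIm3 p * qIm2 q)
     (qRe p * qIm2 q - qIm1 p * qIm3 q + qIm2 p * qRe q + qIm3 p * qIm1 q)
     (qRe p * qIm3 q + qIm1 p * qIm2 q - qIm2 p * qIm1 q + qIm3 p * qRe q)"

instance
  by standard (simp_all add: quat_eq_iff one_quat_def times_quat_def algebra_simps)

end

lemma quat_one_sel [simp]: "qRe 1 = 1" "qIm1 1 = 0" "qIm2 1 = 0" "qIm3 1 = 0"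
  by (simp_all add: one_quat_def)

lemma quat_mult_sel [simp]:
  "qRe (p * q) = qRe p * qRe q - qIm1 p * qIm1 q - qIm2 p * qIm2 q - qIm3 p * qIm3 q"
  "qIm1 (p * q) = qRe p * qIm1 q + qIm1 p * qRe q + qIm2 p * qIm3 q - qIm3 p * qIm2 q"
  "qIm2 (p * q) = qRe p * qIm2 q - qIm1 p * qIm3 q + qIm2 p * qRe q + qIm3 p * qIm1 q"
  "qIm3 (p * q) = qRe p * qIm3 q + qIm1 p * qIm2 q - qIm2 p * qIm1 q + qIm3 p * qRe q"
  by (simp_all add: times_quat_def)

lemma quat_of_real_sel [simp]:
  "qRe (of_real x) = x" "qIm1 (of_real x) = 0" "qIm2 (of_real x) = 0" "qIm3 (of_real x) = 0"
  by (simp_all add: of_real_def)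

instantiation quat :: real_inner
begin

definition inner_quat :: "quat \<Rightarrow> quat \<Rightarrow> real" where
  "inner p q = qRe p * qRe q + qIm1 p * qIm1 q + qIm2 p * qIm2 q + qIm3 p * qIm3 q"

definition norm_quat :: "quat \<Rightarrow> real" where
  "norm (p::quat) = sqrt (inner p p)"

definition sgn_quat :: "quat \<Rightarrow> quat" where
  "sgn (p::quat) = p /\<^sub>R norm p"

definition dist_quat :: "quat \<Rightarrow> quat \<Rightarrow> real" where
  "dist p (q::quat) = norm (p - q)"

definition uniformity_quat :: "(quat \<times> quat) filter" where
  "uniformity = (INF e\<in>{0 <..}. principal {(p::quat, q). dist p q < e})"

definition open_quat :: "quat set \<Rightarrow> bool" where
  "open (U::quat set) \<longleftrightarrow> (\<forall>p\<in>U. \<forall>\<^sub>F (p', q) in uniformity. p' = p \<longrightarrow> q \<in> U)"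

instance
proof
  fix p q r :: quat and a :: real
  show "inner p q = inner q p"
    by (simp add: inner_quat_def algebra_simps)
  show "inner (p + q) r = inner p r + inner q r"
    by (simp add: inner_quat_def algebra_simps)
  show "inner (a *\<^sub>R p) q = a * inner p q"
    by (simp add: inner_quat_def algebra_simps)
  show "0 \<le> inner p p"
    by (simp add: inner_quat_def)
  show "inner p p = 0 \<longleftrightarrow> p = 0"
    using add_nonneg_eq_0_iff[of "qRe p * qRe p + qIm1 p * qIm1 p + qIm2 p * qIm2 p" "qIm3 p * qIm3 p"]
      add_nonneg_eq_0_iff[of "qRe p * qRe p + qIm1 p * qIm1 p" "qIm2 p * qIm2 p"]
    by (auto simp: inner_quat_def quat_eq_iff)
qed (simp_all add: norm_quat_def sgn_quat_def dist_quat_def uniformity_quat_def open_quat_def)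

end

instantiation quat :: real_normed_div_algebra
begin

definition inverse_quat :: "quat \<Rightarrow> quat" where
  "inverse p = Quat (qRe p) (- qIm1 p) (- qIm2 p) (- qIm3 p) /\<^sub>R inner p p"

definition divide_quat :: "quat \<Rightarrow> quat \<Rightarrow> quat" where
  "p div (q::quat) = p * inverse q"

instance
proof
  fix p q :: quat
  show "inverse p * p = 1" if "p \<noteq> 0"
  proof -
    have "inner p p \<noteq> 0" using that by simp
    then show ?thesis
      by (simp add: quat_eq_iff inverse_quat_def field_simps) (simp add: inner_quat_def)
  qed
  show "p * inverse p = 1" if "p \<noteq> 0"
  proof -
    have "inner p p \<noteq> 0" using that by simp
    then show ?thesis
      by (simp add: quat_eq_iff inverse_quat_def field_simps) (simp add: inner_quat_def)
  qed
  show "p div q = p * inverse q"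
    by (simp add: divide_quat_def)
  show "inverse (0::quat) = 0"
    by (simp add: quat_eq_iff inverse_quat_def)
  have "inner (p * q) (p * q) = inner p p * inner q q"
    by (simp add: inner_quat_def algebra_simps)
  then show "norm (p * q) = norm p * norm q"
    by (simp add: norm_quat_def real_sqrt_mult)
qed

end

instantiation quat :: euclidean_space
begin

definition Basis_quat :: "quat set" where
  "Basis = {Quat 1 0 0 0, Quat 0 1 0 0, Quat 0 0 1 0, Quat 0 0 0 1}"

instance
proof
  fix p :: quat
  show "(\<forall>u\<in>Basis. inner p u = 0) \<longleftrightarrow> p = 0"
    by (simp add: Basis_quat_def inner_quat_def) (auto simp: quat_eq_iff)
qed (auto simp: Basis_quat_def inner_quat_def)

end

definition imag_sphere :: "quat set" where
  "imag_sphere = {q. q\<^sup>2 = -1}"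

definition slice_plane :: "quat \<Rightarrow> quat set" where
  "slice_plane I = {of_real x + of_real y * I | x y. True}"

definition upper_half_slice :: "quat \<Rightarrow> quat set" where
  "upper_half_slice I = {of_real x + of_real y * I | x y. y > 0}"

definition slice_open :: "quat set \<Rightarrow> bool" where
  "slice_open \<Omega> \<longleftrightarrow>
     (\<forall>I\<in>imag_sphere. openin (top_of_set (slice_plane I)) (\<Omega> \<inter> slice_plane I))"

definition slice_topology :: "quat topology" where
  "slice_topology = topology slice_open"

lemma istopology_slice_open: "istopology slice_open"
  unfolding istopology_def
proof (intro conjI allI impI)
  fix A B assume A: "slice_open A" and B: "slice_open B"
  have "A \<inter> B \<inter> slice_plane I = (A \<inter> slice_plane I) \<inter> (B \<inter> slice_plane I)" for I
    by blast
  with A B show "slice_open (A \<inter> B)"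
    by (simp add: slice_open_def openin_Int)
next
  fix \<K> assume *: "\<forall>A\<in>\<K>. slice_open A"
  show "slice_open (\<Union>\<K>)"
    unfolding slice_open_def
  proof
    fix I assume I: "I \<in> imag_sphere"
    have "\<Union>\<K> \<inter> slice_plane I = \<Union>((\<lambda>A. A \<inter> slice_plane I) ` \<K>)"
      by blast
    then show "openin (top_of_set (slice_plane I)) (\<Union>\<K> \<inter> slice_plane I)"
      using * I by (metis (no_types, lifting) imageE openin_Union slice_open_def)
  qed
qed

lemma openin_slice_topology [simp]: "openin slice_topology \<Omega> \<longleftrightarrow> slice_open \<Omega>"
  by (simp add: slice_topology_def istopology_slice_open)

definition st_domain :: "quat set \<Rightarrow> bool" where
  "st_domain \<Omega> \<longleftrightarrow> slice_open \<Omega> \<and> connectedin slice_topology \<Omega>"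

text \<open>
  The predicate below is meant for sets \<open>U\<close> that are open in \<open>slice_plane I\<close>; then the partial
  derivatives at points of \<open>U\<close>, and hence the predicate, only depend on the restriction of \<open>h\<close> to \<open>U\<close>.
  The functions \<open>hx\<close> and \<open>hy\<close> are the partial derivatives of \<open>(x, y) \<mapsto> h (x + y I)\<close>.
\<close>

definition left_holomorphic_on :: "quat \<Rightarrow> (quat \<Rightarrow> quat) \<Rightarrow> quat set \<Rightarrow> bool" where
  "left_holomorphic_on I h U \<longleftrightarrow>
     (let D = {(x, y). of_real x + of_real y * I \<in> U} in
      \<exists>hx hy :: real \<times> real \<Rightarrow> quat.
        continuous_on D hx \<and> continuous_on D hy \<and>
        (\<forall>(x, y)\<in>D.
           ((\<lambda>t. h (of_real t + of_real y * I)) has_vector_derivative hx (x, y)) (at x) \<and>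
           ((\<lambda>t. h (of_real x + of_real t * I)) has_vector_derivative hy (x, y)) (at y) \<and>
           (1/2) *\<^sub>R (hx (x, y) + I * hy (x, y)) = 0))"

definition slice_regular_on :: "(quat \<Rightarrow> quat) \<Rightarrow> quat set \<Rightarrow> bool" where
  "slice_regular_on f \<Omega> \<longleftrightarrow>
     slice_open \<Omega> \<and> (\<forall>I\<in>imag_sphere. left_holomorphic_on I f (\<Omega> \<inter> slice_plane I))"

text \<open>
  The values of \<open>F\<close> are column vectors of length two, and the right-hand side below is the matrix
  product of the row vector \<open>(1, I)\<close> with \<open>F (x, y)\<close>.
\<close>

definition slice_function_on :: "(quat \<Rightarrow> quat) \<Rightarrow> quat set \<Rightarrow> bool" where
  "slice_function_on f \<Omega> \<longleftrightarrow>
     (\<exists>F :: real \<times> real \<Rightarrow> quat ^ 2. \<forall>x y. \<forall>I\<in>imag_sphere.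
        y \<ge> 0 \<longrightarrow> of_real x + of_real y * I \<in> \<Omega> \<longrightarrow>
        f (of_real x + of_real y * I) = F (x, y) $ 1 + I * F (x, y) $ 2)"

definition Us_plus :: "quat \<Rightarrow> quat \<Rightarrow> quat set \<Rightarrow> quat set \<Rightarrow> quat set" where
  "Us_plus I1 I2 U1 U2 =
     (U1 \<inter> upper_half_slice I1) \<union> (U2 \<inter> upper_half_slice I2) \<union> (U1 \<inter> U2 \<inter> \<real>)"

definition Us_Delta :: "quat \<Rightarrow> quat \<Rightarrow> quat set \<Rightarrow> quat set \<Rightarrow> quat set" where
  "Us_Delta I1 I2 U1 U2 =
     {of_real x + of_real y * L | x y L. L \<in> imag_sphere \<and> y \<ge> 0 \<and>
        of_real x + of_real y * I1 \<in> U1 \<and> of_real x + of_real y * I2 \<in> U2}"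

definition Us_plus_Delta :: "quat \<Rightarrow> quat \<Rightarrow> quat set \<Rightarrow> quat set \<Rightarrow> quat set" where
  "Us_plus_Delta I1 I2 U1 U2 = Us_plus I1 I2 U1 U2 \<union> Us_Delta I1 I2 U1 U2"

end

theory Submission
  imports Defs "HOL-Complex_Analysis.Conformal_Mappings"
begin

text \<open>
  On the common domain of \<open>f (x + y I1)\<close> and \<open>f (x + y I2)\<close>, solving \<open>A + I1 B = f (x + y I1)\<close>,
  \<open>A + I2 B = f (x + y I2)\<close> gives a pair \<open>(A, B)\<close>, and the two holomorphy conditions combine to the
  Cauchy--Riemann equations \<open>A\<^sub>x = B\<^sub>y\<close>, \<open>A\<^sub>y = - B\<^sub>x\<close>, because \<open>I1 - I2\<close> is invertible.
  Hence \<open>A + L B\<close> is holomorphic on \<open>slice_plane L\<close> for every \<open>L\<close>; this is the extension. Near a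
  real point the upper halves of the slices of \<open>L\<close> and \<open>- L\<close> are glued: \<open>B\<close> vanishes on the real
  axis, so by the identity theorem (Schwarz reflection) \<open>A\<close> is even and \<open>B\<close> is odd in \<open>y\<close>.

  Uniqueness: for each slice of \<open>W\<close>, the accumulation points of the zeros of the difference of two
  extensions form a clopen subset. These subsets agree at real points, because zeros near a real point
  in one slice include a real segment, which lies in all slices; so their union is clopen in the slice
  topology of \<open>W\<close>.
\<close>

subsection \<open>Points of a slice\<close>

text \<open>Complex coordinates on \<open>slice_plane I\<close>: for an imaginary unit this is an
  isometric embedding of the algebra of complex numbers, so openness and derivatives within a slice
  can be studied in type \<open>complex\<close>.\<close>

definition slice_point :: "quat \<Rightarrow> complex \<Rightarrow> quat" where
  "slice_point I z = of_real (Re z) + of_real (Im z) * I"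

text \<open>The Cauchy-Riemann condition packed into one Frechet derivative, which must be left
  multiplication by slice points. The factor \<open>d\<close> stands on the right; its continuity in
  \<open>z\<close> is derived in \<open>slice_holomorphic_derivative_continuous\<close>.\<close>

definition slice_holomorphic :: "quat \<Rightarrow> (complex \<Rightarrow> quat) \<Rightarrow> complex set \<Rightarrow> bool" where
  "slice_holomorphic I k E \<longleftrightarrow>
     (\<forall>z\<in>E. \<exists>d. (k has_derivative (\<lambda>w. slice_point I w * d)) (at z))"

text \<open>The imaginary components of the square of \<open>I\<close> are those of \<open>I\<close>
  times twice its real part. A nonzero real part would therefore make \<open>I\<close> real, with a
  negative square.\<close>

lemma imag_sphere_iff: "I \<in> imag_sphere \<longleftrightarrow> qRe I = 0 \<and> norm I = 1"
proof
  assume "I \<in> imag_sphere"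
  then have e: "qRe I * qRe I - qIm1 I * qIm1 I - qIm2 I * qIm2 I - qIm3 I * qIm3 I = -1"
     "qRe I * qIm1 I = 0" "qRe I * qIm2 I = 0" "qRe I * qIm3 I = 0"
    by (auto simp: imag_sphere_def power2_eq_square quat_eq_iff)
  have "qRe I = 0"
  proof (rule ccontr)
    assume "qRe I \<noteq> 0"
    with e have "qRe I * qRe I = -1" by auto
    then show False by (smt (verit) zero_le_square)
  qed
  with e show "qRe I = 0 \<and> norm I = 1"
    by (simp add: norm_quat_def inner_quat_def)
next
  assume "qRe I = 0 \<and> norm I = 1"
  then show "I \<in> imag_sphere"
    by (auto simp: norm_quat_def inner_quat_def imag_sphere_def power2_eq_square quat_eq_iff)
qed

lemma imag_sphere_square: "I \<in> imag_sphere \<Longrightarrow> I * I = -1"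
  by (simp add: imag_sphere_def power2_eq_square)

lemma imag_sphere_left_square: "I \<in> imag_sphere \<Longrightarrow> I * (I * q) = - q"
  by (metis imag_sphere_square mult.assoc mult_minus1)

lemma uminus_imag_sphere [simp]: "- I \<in> imag_sphere \<longleftrightarrow> I \<in> imag_sphere"
  by (simp add: imag_sphere_def)

lemma slice_point_scaleR: "slice_point I z = Re z *\<^sub>R 1 + Im z *\<^sub>R I"
  by (simp add: slice_point_def of_real_def)

lemma slice_point_mult: "slice_point I z * q = Re z *\<^sub>R q + Im z *\<^sub>R (I * q)"
  by (simp add: slice_point_scaleR algebra_simps)

lemma slice_point_cnj: "slice_point I (cnj z) = slice_point (- I) z"
  by (simp add: slice_point_scaleR)

lemma slice_point_of_real [simp]: "slice_point I (complex_of_real x) = of_real x"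
  by (simp add: slice_point_def)

lemma qRe_slice_point: "I \<in> imag_sphere \<Longrightarrow> qRe (slice_point I z) = Re z"
  by (simp add: slice_point_scaleR imag_sphere_iff)

lemma Im_part_slice_point:
  "I \<in> imag_sphere \<Longrightarrow> slice_point I z - of_real (qRe (slice_point I z)) = Im z *\<^sub>R I"
  by (simp add: qRe_slice_point) (simp add: slice_point_scaleR of_real_def)

lemma slice_point_eq_iff:
  assumes "I \<in> imag_sphere" "J \<in> imag_sphere"
  shows "slice_point I z = slice_point J w \<longleftrightarrow> Re z = Re w \<and> Im z *\<^sub>R I = Im w *\<^sub>R J"
  (is "?l \<longleftrightarrow> ?r")
proof
  assume ?l
  then show ?r
    using Im_part_slice_point[OF assms(1)] Im_part_slice_point[OF assms(2)] qRe_slice_point assms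
    by metis
qed (simp add: slice_point_scaleR)

text \<open>Units have norm 1, so equal imaginary parts force equal absolute values of
  \<open>Im z\<close> and \<open>Im w\<close>; what remains is a choice of sign, or a real point,
  where the two units are unrelated.\<close>

lemma slice_point_eqE:
  assumes "I \<in> imag_sphere" "J \<in> imag_sphere" "slice_point I z = slice_point J w"
  obtains "J = I" "w = z" | "J = - I" "w = cnj z" | "Im z = 0" "w = z"
proof -
  have e: "Re z = Re w" "Im z *\<^sub>R I = Im w *\<^sub>R J"
    using assms slice_point_eq_iff by blast+
  have n: "norm I = 1" "norm J = 1" using assms by (auto simp: imag_sphere_iff)
  have "\<bar>Im z\<bar> = \<bar>Im w\<bar>"
    using arg_cong[OF e(2), of norm] n by simp
  then consider "Im z = 0" "Im w = 0" | "Im w = Im z" "Im z \<noteq> 0" | "Im w = - Im z" "Im z \<noteq> 0"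
    by linarith
  then show ?thesis
  proof cases
    case 1
    then show ?thesis using e that(3) by (simp add: complex_eq_iff)
  next
    case 2
    then show ?thesis using e that(1) by (simp add: complex_eq_iff)
  next
    case 3
    then have "Im z *\<^sub>R I = Im z *\<^sub>R (- J)" using e by simp
    then have "I = - J" using 3 by (metis scaleR_cancel_left)
    then show ?thesis using e 3 that(2) by (simp add: complex_eq_iff)
  qed
qed

section \<open>The slice topology in complex coordinates\<close>

lemma continuous_on_slice_point: "continuous_on S (slice_point I)"
  unfolding slice_point_scaleR[abs_def] by (intro continuous_intros)

lemma slice_plane_eq_range: "slice_plane I = range (slice_point I)"
proof -
  have "of_real x + of_real y * I = slice_point I (Complex x y)" for x y
    by (simp add: slice_point_def)
  then have "slice_plane I \<subseteq> range (slice_point I)"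
    by (auto simp: slice_plane_def)
  then show ?thesis
    by (auto simp: slice_plane_def slice_point_def)
qed

text \<open>\<open>slice_point I\<close> is a homeomorphism from the complex plane onto
  \<open>slice_plane I\<close>.\<close>

lemma openin_slice_plane_iff:
  assumes "I \<in> imag_sphere"
  shows "openin (top_of_set (slice_plane I)) (A \<inter> slice_plane I) \<longleftrightarrow> open (slice_point I -` A)"
proof
  assume "openin (top_of_set (slice_plane I)) (A \<inter> slice_plane I)"
  then obtain T where T: "open T" "A \<inter> slice_plane I = T \<inter> slice_plane I"
    by (metis Int_commute openin_open)
  then have "slice_point I -` A = slice_point I -` T"
    by (auto simp: slice_plane_eq_range)
  then show "open (slice_point I -` A)"
    using T(1) continuous_on_slice_point by (metis continuous_on_open_vimage open_UNIV Int_UNIV_right)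
next
  assume o: "open (slice_point I -` A)"
  \<comment> \<open>Orthogonal projection onto the plane, in coordinates. As 1 and \<open>I\<close>
    are orthonormal, \<open>p\<close> is a continuous left inverse of \<open>slice_point I\<close>
    defined on all quaternions.\<close>
  define p where "p q = complex_of_real (inner q 1) + complex_of_real (inner q I) * \<i>" for q
  have "continuous_on UNIV p"
    unfolding p_def[abs_def] by (intro continuous_intros)
  then have "open (p -` (slice_point I -` A))"
    using o by (metis continuous_on_open_vimage open_UNIV Int_UNIV_right)
  moreover have "p (slice_point I z) = z" for z
  proof -
    have "inner I 1 = 0" "inner 1 I = 0" "inner I I = 1" "inner 1 (1::quat) = 1"
      using assms by (auto simp: imag_sphere_iff inner_quat_def norm_quat_def)
    then show ?thesis
      by (simp add: p_def slice_point_scaleR inner_add_left complex_eq_iff)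
  qed
  then have "A \<inter> slice_plane I = slice_plane I \<inter> (p -` (slice_point I -` A))"
    by (auto simp: slice_plane_eq_range)
  ultimately show "openin (top_of_set (slice_plane I)) (A \<inter> slice_plane I)"
    by (metis openin_open)
qed

lemma slice_open_iff: "slice_open A \<longleftrightarrow> (\<forall>I\<in>imag_sphere. open (slice_point I -` A))"
  by (auto simp: slice_open_def openin_slice_plane_iff)

subsection \<open>Reduction to complex holomorphy\<close>

text \<open>These functionals turn left multiplication by \<open>x + y I\<close> into multiplication by \<open>x + y \<i>\<close>,
  so they carry left holomorphic functions to holomorphic functions of one complex variable; letting
  \<open>v\<close> vary, they separate points.\<close>

definition slice_functional :: "quat \<Rightarrow> quat \<Rightarrow> quat \<Rightarrow> complex" where
  "slice_functional I v q = Complex (inner q v) (- inner (I * q) v)"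

lemma slice_functional_slice_point_mult:
  assumes "I \<in> imag_sphere"
  shows "slice_functional I v (slice_point I z * q) = z * slice_functional I v q"
  by (simp add: slice_functional_def slice_point_mult complex_eq_iff inner_add_left
      inner_diff_left distrib_left imag_sphere_left_square[OF assms])

lemma bounded_linear_slice_functional: "bounded_linear (slice_functional I v)"
proof -
  have "slice_functional I v q = of_real (inner q v) - of_real (inner (I * q) v) * \<i>" for q
    by (simp add: slice_functional_def complex_eq_iff)
  moreover have "bounded_linear (\<lambda>q. complex_of_real (inner q v) - of_real (inner (I * q) v) * \<i>)"
    by (intro bounded_linear_sub bounded_linear_mult_const bounded_linear_compose[OF bounded_linear_of_real]
         bounded_linear_inner_left bounded_linear_compose[OF bounded_linear_inner_left] bounded_linear_mult_right)
  ultimately show ?thesis by (metis (no_types, lifting) ext)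
qed

lemma slice_holomorphic_functional:
  assumes "I \<in> imag_sphere" and "(k has_derivative (\<lambda>w. slice_point I w * d)) (at z)"
  shows "((\<lambda>w. slice_functional I v (k w)) has_field_derivative slice_functional I v d) (at z)"
  using bounded_linear.has_derivative[OF bounded_linear_slice_functional assms(2), of I v]
  by (simp add: slice_functional_slice_point_mult[OF assms(1)] has_field_derivative_def mult_commute_abs)

lemma slice_holomorphic_imp_holomorphic:
  assumes "I \<in> imag_sphere" and "slice_holomorphic I k E" and "open E"
  shows "(\<lambda>w. slice_functional I v (k w)) holomorphic_on E"
proof -
  have "(\<lambda>w. slice_functional I v (k w)) field_differentiable (at z)" if "z \<in> E" for z
    using assms that slice_holomorphic_functional unfolding slice_holomorphic_def field_differentiable_def
    by blast
  then show ?thesis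
    using \<open>open E\<close> by (simp add: holomorphic_on_open field_differentiable_def)
qed

text \<open>The identity theorem of one complex variable, applied to a functional of
  \<open>k\<close> that detects whether \<open>k w\<close> vanishes.\<close>

lemma slice_holomorphic_identity:
  assumes I: "I \<in> imag_sphere" and "slice_holomorphic I k S" "open S" "connected S"
    and "\<xi> \<in> S" "\<xi> islimpt {z. k z = 0}" "w \<in> S"
  shows "k w = 0"
proof -
  obtain r where r: "r > 0" "ball \<xi> r \<subseteq> S" using assms by (meson openE)
  have "\<xi> islimpt ({z. k z = 0} \<inter> ball \<xi> r)"
  proof (rule islimptI)
    fix T assume "\<xi> \<in> T" "open T"
    then have "\<xi> \<in> T \<inter> ball \<xi> r" "open (T \<inter> ball \<xi> r)" using r(1) by auto
    from islimptE[OF assms(6) this]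
    show "\<exists>y\<in>{z. k z = 0} \<inter> ball \<xi> r. y \<in> T \<and> y \<noteq> \<xi>" by blast
  qed
  then have lim: "\<xi> islimpt (S \<inter> {z. k z = 0})"
    by (rule islimpt_subset) (use r(2) in blast)
  \<comment> \<open>With the direction \<open>v = k w\<close> the real part of the functional at
    \<open>w\<close> is the squared norm of \<open>k w\<close>.\<close>
  have "slice_functional I (k w) (k w) = 0"
    by (rule analytic_continuation[OF slice_holomorphic_imp_holomorphic[OF I assms(2,3)] assms(3,4)
          _ assms(5) lim _ assms(7)]) (simp_all add: slice_functional_def complex_eq_iff)
  then show ?thesis by (simp add: slice_functional_def complex_eq_iff)
qed

text \<open>Every real component of \<open>d\<close> is the real part of the derivative of a
  holomorphic function, and such derivatives are continuous.\<close>

lemma slice_holomorphic_derivative_continuous: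
  assumes I: "I \<in> imag_sphere" and "open E"
    and d: "\<And>z. z \<in> E \<Longrightarrow> (k has_derivative (\<lambda>w. slice_point I w * d z)) (at z)"
  shows "continuous_on E d"
proof -
  have "continuous_on E (\<lambda>z. inner (d z) v)" for v
  proof -
    have h: "(\<lambda>w. slice_functional I v (k w)) holomorphic_on E"
      by (rule slice_holomorphic_imp_holomorphic[OF I]) (use d \<open>open E\<close> in \<open>auto simp: slice_holomorphic_def\<close>)
    have "inner (d z) v = Re (deriv (\<lambda>w. slice_functional I v (k w)) z)" if "z \<in> E" for z
      using DERIV_imp_deriv[OF slice_holomorphic_functional[OF I d[OF that], of v]]
      by (simp add: slice_functional_def)
    moreover have "continuous_on E (\<lambda>z. Re (deriv (\<lambda>w. slice_functional I v (k w)) z))"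
      by (intro continuous_on_Re holomorphic_on_imp_continuous_on holomorphic_deriv h \<open>open E\<close>)
    ultimately show ?thesis by (simp cong: continuous_on_cong)
  qed
  then show ?thesis using continuous_on_componentwise by blast
qed

text \<open>Continuous partial derivatives give a total derivative, which the equation
  \<open>hy = I * hx\<close> turns into left multiplication by slice points. Conversely the partial
  derivatives are \<open>d\<close> and \<open>I * d\<close>, continuous because \<open>d\<close>
  is.\<close>

lemma left_holomorphic_on_iff:
  assumes I: "I \<in> imag_sphere" and o: "open (slice_point I -` U)"
  shows "left_holomorphic_on I h U \<longleftrightarrow> slice_holomorphic I (h \<circ> slice_point I) (slice_point I -` U)"
    (is "_ \<longleftrightarrow> slice_holomorphic I ?k ?E")
proof -
  define D where "D = {(x, y). of_real x + of_real y * I \<in> U}"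
  have D: "(x, y) \<in> D \<longleftrightarrow> Complex x y \<in> ?E" for x y
    by (simp add: D_def slice_point_def)
  have cont: "continuous_on S (\<lambda>p. Complex (fst p) (snd p))" for S :: "(real \<times> real) set"
    unfolding Complex_eq by (intro continuous_intros)
  have "D = (\<lambda>p. Complex (fst p) (snd p)) -` ?E"
    using D by auto
  then have "open D"
    using cont o by (metis continuous_on_open_vimage open_UNIV Int_UNIV_right)
  show ?thesis
  proof
    assume "left_holomorphic_on I h U"
    then obtain hx hy where hy_cont: "continuous_on D hy"
      and hxy: "\<And>x y. (x, y) \<in> D \<Longrightarrow>
           ((\<lambda>t. h (of_real t + of_real y * I)) has_vector_derivative hx (x, y)) (at x) \<and>
           ((\<lambda>t. h (of_real x + of_real t * I)) has_vector_derivative hy (x, y)) (at y) \<and>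
           (1/2) *\<^sub>R (hx (x, y) + I * hy (x, y)) = 0"
      unfolding left_holomorphic_on_def Let_def D_def by blast
    show "slice_holomorphic I ?k ?E"
      unfolding slice_holomorphic_def
    proof
      fix z assume "z \<in> ?E"
      define x y where "x = Re z" and "y = Im z"
      have xy: "(x, y) \<in> D" using \<open>z \<in> ?E\<close> by (simp add: D x_def y_def)
      obtain X Y' where X: "open X" "open Y'" "x \<in> X" "y \<in> Y'" "X \<times> Y' \<subseteq> D"
        using \<open>open D\<close> xy by (rule open_prod_elim) (auto simp: mem_Sigma_iff)
      \<comment> \<open>The second factor of the box is shrunk to a ball because
        \<open>has_derivative_partialsI\<close> asks for a convex set there.\<close>
      obtain r where r: "r > 0" "ball y r \<subseteq> Y'"
        using X(2,4) by (rule openE)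
      define Y where "Y = ball y r"
      have XY: "X \<times> Y \<subseteq> D"
        using X(5) r(2) unfolding Y_def by blast
      have XY_open: "open (X \<times> Y)"
        unfolding Y_def by (intro open_Times X(1) open_ball)
      have y_Y: "y \<in> Y" using r(1) by (simp add: Y_def)
      define g where "g = (\<lambda>x y. h (of_real x + of_real y * I))"
      have "((\<lambda>(x, y). g x y) has_derivative
           (\<lambda>(tx, ty). tx *\<^sub>R hx (x, y) + blinfun_scaleR_left (hy (x, y)) ty)) (at (x, y) within X \<times> Y)"
      proof (rule has_derivative_partialsI[where fx = "\<lambda>t. t *\<^sub>R hx (x, y)"
              and fy = "\<lambda>x y. blinfun_scaleR_left (hy (x, y))"])
        show "((\<lambda>x. g x y) has_derivative (\<lambda>t. t *\<^sub>R hx (x, y))) (at x within X)"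
          using hxy[OF xy] unfolding g_def has_vector_derivative_def
          by (simp add: has_derivative_at_withinI)
        show "((\<lambda>y. g x' y) has_derivative blinfun_apply (blinfun_scaleR_left (hy (x', y')))) (at y' within Y)"
          if "x' \<in> X" "y' \<in> Y" for x' y'
        proof -
          have "(x', y') \<in> D" using that XY by blast
          from hxy[OF this] have "((\<lambda>y. g x' y) has_derivative (\<lambda>t. t *\<^sub>R hy (x', y'))) (at y' within Y)"
            unfolding g_def has_vector_derivative_def by (simp add: has_derivative_at_withinI)
          then show ?thesis by simp
        qed
        have "continuous_on (X \<times> Y) (\<lambda>p. blinfun_scaleR_left (hy p))"
          by (rule bounded_linear.continuous_on[OF bounded_linear_blinfun_scaleR_left
              continuous_on_subset[OF hy_cont XY]])
        then show "continuous (at (x, y) within X \<times> Y) (\<lambda>(x, y). blinfun_scaleR_left (hy (x, y)))"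
          using X(3) y_Y by (simp add: continuous_on_eq_continuous_within split_beta')
      qed (simp_all add: y_Y, simp add: Y_def)
      moreover have "at (x, y) within X \<times> Y = at (x, y)"
        by (rule at_within_open[OF _ XY_open]) (simp add: X(3) y_Y)
      ultimately have g: "((\<lambda>(x, y). g x y) has_derivative
           (\<lambda>(tx, ty). tx *\<^sub>R hx (x, y) + ty *\<^sub>R hy (x, y))) (at (x, y))"
        by simp
      have "((\<lambda>w. (Re w, Im w)) has_derivative (\<lambda>w. (Re w, Im w))) (at z)"
        by (intro derivative_eq_intros) auto
      from has_derivative_compose[OF this g[unfolded x_def y_def]]
      have "(?k has_derivative (\<lambda>w. Re w *\<^sub>R hx (x, y) + Im w *\<^sub>R hy (x, y))) (at z)"
        by (simp add: x_def y_def g_def slice_point_def o_def)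
      \<comment> \<open>Left multiplication of the Cauchy-Riemann equation by \<open>I\<close> turns
        the term in \<open>hy\<close> into \<open>- hy\<close>.\<close>
      moreover have "hy (x, y) = I * hx (x, y)"
      proof -
        have "hx (x, y) + I * hy (x, y) = 0" using hxy[OF xy] by simp
        then have "I * hx (x, y) + I * (I * hy (x, y)) = 0" by (metis distrib_left mult_zero_right)
        then show ?thesis by (simp add: imag_sphere_left_square[OF I])
      qed
      ultimately show "\<exists>d. (?k has_derivative (\<lambda>w. slice_point I w * d)) (at z)"
        by (auto simp: slice_point_mult)
    qed
  next
    assume "slice_holomorphic I ?k ?E"
    then obtain d where d: "\<And>z. z \<in> ?E \<Longrightarrow> (?k has_derivative (\<lambda>w. slice_point I w * d z)) (at z)"
      unfolding slice_holomorphic_def by metis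
    have dc: "continuous_on ?E d"
      by (rule slice_holomorphic_derivative_continuous[OF I o d])
    have "continuous_on D (\<lambda>p. d (Complex (fst p) (snd p)))"
      by (rule continuous_on_compose2[OF dc cont]) (use D in auto)
    moreover from this have "continuous_on D (\<lambda>p. I * d (Complex (fst p) (snd p)))"
      by (intro continuous_intros)
    moreover have "((\<lambda>t. h (of_real t + of_real y * I)) has_vector_derivative d (Complex x y)) (at x) \<and>
           ((\<lambda>t. h (of_real x + of_real t * I)) has_vector_derivative I * d (Complex x y)) (at y)"
      if "(x, y) \<in> D" for x y
    proof -
      have k: "(?k has_derivative (\<lambda>w. slice_point I w * d (Complex x y))) (at (Complex x y))"
        using that by (intro d) (simp add: D)
      have "((\<lambda>t. Complex t y) has_derivative complex_of_real) (at x)"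
           "((\<lambda>t. Complex x t) has_derivative (\<lambda>t. \<i> * complex_of_real t)) (at y)"
        unfolding Complex_eq[abs_def] by (auto intro!: derivative_eq_intros)
      from this[THEN has_derivative_compose, OF k] show ?thesis
        by (simp add: has_vector_derivative_def slice_point_def scaleR_conv_of_real mult.assoc)
    qed
    moreover have "(1/2) *\<^sub>R (d z + I * (I * d z)) = 0" for z
      by (simp add: imag_sphere_left_square[OF I])
    ultimately show "left_holomorphic_on I h U"
      unfolding left_holomorphic_on_def Let_def D_def[symmetric]
      by (intro exI[of _ "\<lambda>p. d (Complex (fst p) (snd p))"]
          exI[of _ "\<lambda>p. I * d (Complex (fst p) (snd p))"]) auto
  qed
qed

lemma slice_regular_on_iff:
  "slice_regular_on f A \<longleftrightarrow> (\<forall>I\<in>imag_sphere. open (slice_point I -` A) \<and>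
     slice_holomorphic I (f \<circ> slice_point I) (slice_point I -` A))"
proof -
  have "slice_point I -` (A \<inter> slice_plane I) = slice_point I -` A" for I
    by (auto simp: slice_plane_eq_range)
  then show ?thesis
    unfolding slice_regular_on_def slice_open_iff
    by (metis left_holomorphic_on_iff)
qed

section \<open>Closure properties of slice holomorphy\<close>

lemma slice_holomorphic_diff:
  assumes "slice_holomorphic I k E" "slice_holomorphic I l E"
  shows "slice_holomorphic I (\<lambda>z. k z - l z) E"
  unfolding slice_holomorphic_def
proof
  fix z assume "z \<in> E"
  then obtain a b where "(k has_derivative (\<lambda>w. slice_point I w * a)) (at z)"
     "(l has_derivative (\<lambda>w. slice_point I w * b)) (at z)"
    using assms unfolding slice_holomorphic_def by blast
  from has_derivative_diff[OF this]
  show "\<exists>d. ((\<lambda>z. k z - l z) has_derivative (\<lambda>w. slice_point I w * d)) (at z)"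
    by (intro exI[of _ "a - b"]) (simp add: right_diff_distrib)
qed

lemma slice_holomorphic_subset: "slice_holomorphic I k E \<Longrightarrow> F \<subseteq> E \<Longrightarrow> slice_holomorphic I k F"
  by (auto simp: slice_holomorphic_def)

text \<open>The slices of \<open>I\<close> and \<open>- I\<close> are the same plane with conjugate
  coordinates. This later reduces lower half-planes to upper ones.\<close>

lemma slice_holomorphic_cnj:
  assumes "slice_holomorphic I k E"
  shows "slice_holomorphic (- I) (k \<circ> cnj) (cnj -` E)"
  unfolding slice_holomorphic_def
proof
  fix z assume "z \<in> cnj -` E"
  then obtain d where d: "(k has_derivative (\<lambda>w. slice_point I w * d)) (at (cnj z))"
    using assms unfolding slice_holomorphic_def by blast
  have "(cnj has_derivative cnj) (at z)"
    by (rule bounded_linear_imp_has_derivative[OF bounded_linear_cnj])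
  from has_derivative_compose[OF this d]
  show "\<exists>d. (k \<circ> cnj has_derivative (\<lambda>w. slice_point (- I) w * d)) (at z)"
    by (auto simp: slice_point_cnj o_def)
qed

text \<open>Differentiability is local, so a function may be given by a different formula
  \<open>l\<close> near each point.\<close>

lemma slice_holomorphic_local:
  assumes "\<And>z. z \<in> E \<Longrightarrow> \<exists>N l. open N \<and> z \<in> N \<and> slice_holomorphic I l N \<and> (\<forall>w\<in>N. k w = l w)"
  shows "slice_holomorphic I k E"
  unfolding slice_holomorphic_def
proof
  fix z assume "z \<in> E"
  from assms[OF this] obtain N l where N: "open N" "z \<in> N" "slice_holomorphic I l N" "\<forall>w\<in>N. k w = l w"
    by blast
  then obtain d where "(l has_derivative (\<lambda>w. slice_point I w * d)) (at z)"
    unfolding slice_holomorphic_def by blast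
  then have "(k has_derivative (\<lambda>w. slice_point I w * d)) (at z)"
    by (rule has_derivative_transform_within_open[OF _ N(1,2)]) (use N(4) in simp)
  then show "\<exists>d. (k has_derivative (\<lambda>w. slice_point I w * d)) (at z)" ..
qed

lemma slice_point_eq_upper_iff:
  assumes "I \<in> imag_sphere" "J \<in> imag_sphere" "Im z \<ge> 0" "Im w \<ge> 0"
  shows "slice_point I z = slice_point J w \<longleftrightarrow> z = w \<and> (Im z = 0 \<or> I = J)"
proof
  assume "slice_point I z = slice_point J w"
  with assms(1,2) show "z = w \<and> (Im z = 0 \<or> I = J)"
    by (rule slice_point_eqE) (use assms(3,4) in \<open>auto simp: complex_eq_iff\<close>)
qed (auto simp: slice_point_scaleR)

lemma slice_point_surj:
  obtains I z where "I \<in> imag_sphere" "Im z \<ge> 0" "q = slice_point I z"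
proof -
  define v where "v = q - of_real (qRe q)"
  show ?thesis
  proof (cases "v = 0")
    case True
    \<comment> \<open>A real point lies in every slice; this unit is an arbitrary choice.\<close>
    have "Quat 0 1 0 0 \<in> imag_sphere" by (simp add: imag_sphere_iff norm_quat_def inner_quat_def)
    with True show ?thesis
      by (intro that[of "Quat 0 1 0 0" "of_real (qRe q)"]) (simp_all add: v_def)
  next
    case False
    then have "sgn v \<in> imag_sphere"
      by (simp add: imag_sphere_iff norm_sgn) (simp add: sgn_div_norm v_def)
    moreover have "q = slice_point (sgn v) (Complex (qRe q) (norm v))"
      using False by (simp add: slice_point_def scaleR_conv_of_real[symmetric] sgn_div_norm) (simp add: v_def)
    ultimately show ?thesis using that[of "sgn v" "Complex (qRe q) (norm v)"] by simp
  qed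
qed

section \<open>The identity principle on st-domains\<close>

lemma islimpt_real_points:
  assumes "r > 0"
  shows "complex_of_real x islimpt of_real ` ball x r"
proof (rule islimptI)
  fix T assume "complex_of_real x \<in> T" "open T"
  then have T: "x \<in> of_real -` T" "open ((of_real :: real \<Rightarrow> complex) -` T)"
    by (simp_all add: open_vimage continuous_on_of_real)
  have "x islimpt ball x r"
    using assms by (simp add: islimpt_ball)
  then obtain y where "y \<in> ball x r" "y \<in> of_real -` T" "y \<noteq> x"
    using T by (rule islimptE)
  then show "\<exists>y\<in>of_real ` ball x r. y \<in> T \<and> y \<noteq> complex_of_real x"
    by (intro bexI[of _ "of_real y"]) simp_all
qed

lemma slice_identity_principle:
  assumes W: "st_domain W"
    and h: "\<And>L. L \<in> imag_sphere \<Longrightarrow> slice_holomorphic L (h \<circ> slice_point L) (slice_point L -` W)"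
    and J: "J \<in> imag_sphere" "slice_point J \<xi> \<in> W" "\<xi> islimpt {z. h (slice_point J z) = 0}"
    and q: "q \<in> W"
  shows "h q = 0"
proof -
  define E where "E L = slice_point L -` W" for L
  define Z where "Z L = {z \<in> E L. z islimpt {z. h (slice_point L z) = 0}}" for L
  define A where "A = {slice_point L z | L z. L \<in> imag_sphere \<and> z \<in> Z L}"
  have E_open: "open (E L)" if "L \<in> imag_sphere" for L
    using W that by (simp add: st_domain_def slice_open_iff E_def)
  \<comment> \<open>By the identity theorem on a ball inside \<open>E L\<close>, \<open>h\<close>
    vanishes on the whole ball, each point of which is then again an accumulation point of
    zeros.\<close>
  have Z_ball: "\<exists>r>0. ball z r \<subseteq> Z L \<and> (\<forall>w\<in>ball z r. h (slice_point L w) = 0)"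
    if L: "L \<in> imag_sphere" and z: "z \<in> Z L" for L z
  proof -
    have "z \<in> E L" using z by (simp add: Z_def)
    obtain r where r: "r > 0" "ball z r \<subseteq> E L"
      using E_open[OF L] \<open>z \<in> E L\<close> by (rule openE)
    have zero: "h (slice_point L w) = 0" if "w \<in> ball z r" for w
    proof -
      have hol: "slice_holomorphic L (h \<circ> slice_point L) (ball z r)"
        using h[OF L] r(2) unfolding E_def by (rule slice_holomorphic_subset)
      have lim: "z islimpt {z. (h \<circ> slice_point L) z = 0}"
        using z by (simp add: Z_def)
      show ?thesis
        using slice_holomorphic_identity[OF L hol open_ball connected_ball _ lim that] r(1) by simp
    qed
    have "w \<in> Z L" if "w \<in> ball z r" for w
    proof -
      have "w islimpt ball z r"
        using that r(1) by (simp add: islimpt_ball)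
      moreover have "ball z r \<subseteq> {z. h (slice_point L z) = 0}"
        using zero by (intro subsetI CollectI)
      ultimately have "w islimpt {z. h (slice_point L z) = 0}"
        by (rule islimpt_subset)
      moreover have "w \<in> E L" using that r(2) by (rule rev_subsetD)
      ultimately show ?thesis by (simp add: Z_def)
    qed
    then have "ball z r \<subseteq> Z L" by (rule subsetI)
    with r(1) zero show ?thesis by (intro exI[of _ r] conjI ballI)
  qed
  have Z_open: "open (Z L)" if "L \<in> imag_sphere" for L
    using Z_ball[OF that] by (metis openI open_contains_ball)
  \<comment> \<open>The set of all limit points is closed, which makes this complement open.\<close>
  have EZ: "E L - Z L = E L - {z. z islimpt {z. h (slice_point L z) = 0}}" for L
    by (auto simp: Z_def)
  have EZ_open: "open (E L - Z L)" if "L \<in> imag_sphere" for L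
    unfolding EZ using E_open[OF that] closed_limpts by (rule open_Diff)
  \<comment> \<open>Compatibility of the slices: a point of \<open>A\<close> seen through another
    slice is an accumulation point of zeros there too. Hence \<open>A\<close> and
    \<open>W - A\<close> can be tested for openness slice by slice.\<close>
  have A_vimage: "slice_point L -` A = Z L" if L: "L \<in> imag_sphere" for L
  proof
    show "Z L \<subseteq> slice_point L -` A"
      unfolding A_def using L by blast
    show "slice_point L -` A \<subseteq> Z L"
    proof
      fix z assume "z \<in> slice_point L -` A"
      then obtain M w where M: "M \<in> imag_sphere" "w \<in> Z M" "slice_point L z = slice_point M w"
        unfolding A_def by blast
      have "slice_point M w \<in> W" using M(2) by (simp add: Z_def E_def)
      then have zE: "z \<in> E L" using M(3) by (simp add: E_def)
      obtain r where r: "r > 0" "\<forall>v\<in>ball w r. h (slice_point M v) = 0"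
        using Z_ball[OF M(1,2)] by blast
      from L M(1,3) show "z \<in> Z L"
      proof (cases rule: slice_point_eqE)
        case 1
        then show ?thesis using M(2) by simp
      next
        case 2
        \<comment> \<open>Opposite units: conjugation is an isometry and carries the ball of zeros
          around \<open>w\<close> to the one around \<open>z\<close>.\<close>
        have "ball z r \<subseteq> {v. h (slice_point L v) = 0}"
        proof
          fix v assume "v \<in> ball z r"
          then have "cnj v \<in> ball w r"
            using 2 by (metis complex_cnj_diff complex_mod_cnj dist_norm mem_ball)
          then have "h (slice_point M (cnj v)) = 0" using r(2) by blast
          then show "v \<in> {v. h (slice_point L v) = 0}"
            using 2 by (simp add: slice_point_cnj)
        qed
        moreover have "z islimpt ball z r"
          using r(1) by (simp add: islimpt_ball)
        ultimately show ?thesis using zE by (auto simp: Z_def intro: islimpt_subset)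
      next
        case 3
        have z: "z = of_real (Re z)" using 3 by (simp add: complex_eq_iff)
        \<comment> \<open>Real point: of the ball of zeros in the slice of \<open>M\<close> only the
          real diameter is known to lie in the slice of \<open>L\<close>, and it already accumulates
          at \<open>z\<close>.\<close>
        have "of_real ` ball (Re z) r \<subseteq> {v. h (slice_point L v) = 0}"
        proof safe
          fix t assume "t \<in> ball (Re z) r"
          then have "complex_of_real t \<in> ball w r"
            using 3 z by (metis dist_of_real mem_ball)
          then have "h (slice_point M (of_real t)) = 0" using r(2) by blast
          then show "h (slice_point L (of_real t)) = 0" by simp
        qed
        moreover have "z islimpt of_real ` ball (Re z) r"
          using islimpt_real_points[OF r(1), of "Re z"] z by simp
        ultimately show ?thesis using zE by (auto simp: Z_def intro: islimpt_subset)
      qed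
    qed
  qed
  have "slice_open A" using A_vimage Z_open by (simp add: slice_open_iff)
  moreover have "slice_open (W - A)"
    using A_vimage EZ_open by (simp add: slice_open_iff E_def vimage_Diff)
  moreover have "\<xi> \<in> Z J"
    using J(2,3) by (simp add: Z_def E_def)
  then have "slice_point J \<xi> \<in> A"
    using A_vimage[OF J(1)] by blast
  then have "A \<inter> W \<noteq> {}" using J(2) by blast
  moreover have "connectedin slice_topology W"
    using W by (simp add: st_domain_def)
  moreover have "W \<subseteq> A \<union> (W - A)" "A \<inter> (W - A) \<inter> W = {}" by blast+
  \<comment> \<open>Connectedness of \<open>W\<close>: of the two disjoint slice-open sets covering
    it, \<open>A\<close> meets \<open>W\<close>, so the other cannot.\<close>
  ultimately have "(W - A) \<inter> W = {}"
    unfolding connectedin openin_slice_topology by metis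
  with q have "q \<in> A" by blast
  then obtain L z where "L \<in> imag_sphere" "z \<in> Z L" "q = slice_point L z" unfolding A_def by blast
  then show ?thesis using Z_ball[of L z] by force
qed

subsection \<open>Stem functions\<close>

text \<open>The Cauchy-Riemann equations for a pair of quaternion-valued functions: \<open>a\<close>
  is the x-derivative of \<open>A\<close> and the y-derivative of \<open>B\<close>, while
  \<open>b\<close> is the x-derivative of \<open>B\<close> and minus the y-derivative of
  \<open>A\<close>. No unit occurs, so one pair serves all slices.\<close>

definition stem_pair :: "(complex \<Rightarrow> quat) \<Rightarrow> (complex \<Rightarrow> quat) \<Rightarrow> complex set \<Rightarrow> bool" where
  "stem_pair A B E \<longleftrightarrow> (\<forall>z\<in>E. \<exists>a b.
     (A has_derivative (\<lambda>w. Re w *\<^sub>R a - Im w *\<^sub>R b)) (at z) \<and>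
     (B has_derivative (\<lambda>w. Re w *\<^sub>R b + Im w *\<^sub>R a)) (at z))"

text \<open>Since \<open>L * L = -1\<close>, the combined derivative factors as
  \<open>slice_point L w * (a + L * b)\<close>.\<close>

lemma stem_pair_slice_holomorphic:
  assumes L: "L \<in> imag_sphere" and "stem_pair A B E"
  shows "slice_holomorphic L (\<lambda>z. A z + L * B z) E"
  unfolding slice_holomorphic_def
proof
  fix z assume "z \<in> E"
  then obtain a b where A: "(A has_derivative (\<lambda>w. Re w *\<^sub>R a - Im w *\<^sub>R b)) (at z)"
    and B: "(B has_derivative (\<lambda>w. Re w *\<^sub>R b + Im w *\<^sub>R a)) (at z)"
    using assms(2) unfolding stem_pair_def by blast
  have "((\<lambda>z. A z + L * B z) has_derivative
      (\<lambda>w. (Re w *\<^sub>R a - Im w *\<^sub>R b) + L * (Re w *\<^sub>R b + Im w *\<^sub>R a))) (at z)"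
    by (intro has_derivative_add[OF A] has_derivative_mult_right B)
  moreover have "(Re w *\<^sub>R a - Im w *\<^sub>R b) + L * (Re w *\<^sub>R b + Im w *\<^sub>R a) = slice_point L w * (a + L * b)" for w
    by (simp add: slice_point_mult distrib_left scaleR_add_right imag_sphere_left_square[OF L])
  ultimately show "\<exists>d. ((\<lambda>z. A z + L * B z) has_derivative (\<lambda>w. slice_point L w * d)) (at z)"
    by auto
qed

text \<open>Conjugation reverses the sign of \<open>Im w\<close> in both derivatives; the minus sign
  before \<open>B\<close> restores the equations, with \<open>- b\<close> in place of
  \<open>b\<close>.\<close>

lemma stem_pair_cnj:
  assumes "stem_pair A B E"
  shows "stem_pair (\<lambda>z. A (cnj z)) (\<lambda>z. - B (cnj z)) (cnj -` E)"
  unfolding stem_pair_def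
proof
  fix z assume "z \<in> cnj -` E"
  then obtain a b where A: "(A has_derivative (\<lambda>w. Re w *\<^sub>R a - Im w *\<^sub>R b)) (at (cnj z))"
    and B: "(B has_derivative (\<lambda>w. Re w *\<^sub>R b + Im w *\<^sub>R a)) (at (cnj z))"
    using assms unfolding stem_pair_def by blast
  have c: "(cnj has_derivative cnj) (at z)"
    by (rule bounded_linear_imp_has_derivative[OF bounded_linear_cnj])
  show "\<exists>a b. ((\<lambda>z. A (cnj z)) has_derivative (\<lambda>w. Re w *\<^sub>R a - Im w *\<^sub>R b)) (at z) \<and>
     ((\<lambda>z. - B (cnj z)) has_derivative (\<lambda>w. Re w *\<^sub>R b + Im w *\<^sub>R a)) (at z)"
    using has_derivative_compose[OF c A] has_derivative_minus[OF has_derivative_compose[OF c B]]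
    by (intro exI[of _ a] exI[of _ "- b"]) (simp add: algebra_simps)
qed

text \<open>Schwarz reflection: both sides are holomorphic in the slice of \<open>L\<close> on a
  disc that conjugation preserves, its centre being real, and they agree on the real diameter
  because \<open>B\<close> vanishes there.\<close>

lemma stem_pair_reflection:
  assumes L: "L \<in> imag_sphere" and AB: "stem_pair A B (ball (of_real x) r)"
    and real: "\<And>t. of_real t \<in> ball (complex_of_real x) r \<Longrightarrow> B (of_real t) = 0"
    and z: "z \<in> ball (of_real x) r"
  shows "A (cnj z) - L * B (cnj z) = A z + L * B z"
proof -
  let ?S = "ball (complex_of_real x) r"
  define k where "k z = (A z + L * B z) - (A (cnj z) + L * (- B (cnj z)))" for z
  have "dist (complex_of_real x) (cnj v) = dist (of_real x) v" for v
    by (metis complex_cnj_complex_of_real complex_cnj_diff complex_mod_cnj dist_norm)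
  then have "cnj -` ?S = ?S" by auto
  then have "slice_holomorphic L k ?S"
    using stem_pair_cnj[OF AB] unfolding k_def
    by (intro slice_holomorphic_diff stem_pair_slice_holomorphic L AB) simp
  moreover have "r > 0" using z by (metis ball_empty empty_iff not_less)
  moreover have "of_real ` ball x r \<subseteq> {z. k z = 0}"
    using real by (auto simp: k_def)
  then have "of_real x islimpt {z. k z = 0}"
    using islimpt_real_points[OF \<open>r > 0\<close>] islimpt_subset by blast
  ultimately have "k z = 0"
    by (intro slice_holomorphic_identity[OF L _ open_ball connected_ball _ _ z]) simp_all
  then show ?thesis by (simp add: k_def)
qed

text \<open>The two functions are the solution \<open>A\<close>, \<open>B\<close> of
  \<open>A + I * B = k\<close> and \<open>A + J * B = l\<close>; their derivatives solve the same
  linear system, whose coefficients are constant.\<close>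

lemma stem_pair_from_two_slices:
  assumes I: "I \<in> imag_sphere" "J \<in> imag_sphere" "I \<noteq> J"
    and k: "slice_holomorphic I k E" and l: "slice_holomorphic J l E"
  shows "stem_pair (\<lambda>z. k z - I * (inverse (I - J) * (k z - l z))) (\<lambda>z. inverse (I - J) * (k z - l z)) E"
  unfolding stem_pair_def
proof
  fix z assume "z \<in> E"
  obtain d where d: "(k has_derivative (\<lambda>w. slice_point I w * d)) (at z)"
    using k \<open>z \<in> E\<close> unfolding slice_holomorphic_def by blast
  obtain e where e: "(l has_derivative (\<lambda>w. slice_point J w * e)) (at z)"
    using l \<open>z \<in> E\<close> unfolding slice_holomorphic_def by blast
  define c where "c = inverse (I - J)"
  \<comment> \<open>Chosen so that \<open>d = a + I * b\<close> and
    \<open>e = a + J * b\<close>.\<close>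
  define b where "b = c * (d - e)"
  define a where "a = d - I * b"
  have "c * (I - J) = 1" "(I - J) * c = 1"
    using I(3) by (simp_all add: c_def left_inverse right_inverse)
  then have c: "c * ((I - J) * q) = q" "(I - J) * (c * q) = q" for q
    unfolding mult.assoc[symmetric] by simp_all
  have da: "d = a + I * b" by (simp add: a_def)
  have "d - e = (I - J) * b" by (simp add: b_def c)
  then have ea: "e = a + J * b" by (simp add: a_def algebra_simps)
  \<comment> \<open>The terms in \<open>I * I * b\<close> and \<open>J * J * b\<close> both reduce
    to \<open>- b\<close> and cancel, which leaves the factor \<open>I - J\<close> on the
    left.\<close>
  have "slice_point I w * d - slice_point J w * e = (I - J) * (Re w *\<^sub>R b + Im w *\<^sub>R a)" for w
    unfolding da ea slice_point_mult
    by (simp add: algebra_simps imag_sphere_left_square I)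
  then have eqB: "c * (slice_point I w * d - slice_point J w * e) = Re w *\<^sub>R b + Im w *\<^sub>R a" for w
    by (simp add: c)
  have eqA: "slice_point I w * d - I * (Re w *\<^sub>R b + Im w *\<^sub>R a) = Re w *\<^sub>R a - Im w *\<^sub>R b" for w
    unfolding da slice_point_mult by (simp add: algebra_simps imag_sphere_left_square I)
  have B: "((\<lambda>z. c * (k z - l z)) has_derivative (\<lambda>w. Re w *\<^sub>R b + Im w *\<^sub>R a)) (at z)"
    using has_derivative_mult_right[OF has_derivative_diff[OF d e], of c] by (simp add: eqB)
  have "((\<lambda>z. k z - I * (c * (k z - l z))) has_derivative (\<lambda>w. Re w *\<^sub>R a - Im w *\<^sub>R b)) (at z)"
    using has_derivative_diff[OF d has_derivative_mult_right[OF B, of I]] by (simp add: eqA)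
  with B show "\<exists>a b. ((\<lambda>z. k z - I * (inverse (I - J) * (k z - l z))) has_derivative
        (\<lambda>w. Re w *\<^sub>R a - Im w *\<^sub>R b)) (at z) \<and>
      ((\<lambda>z. inverse (I - J) * (k z - l z)) has_derivative (\<lambda>w. Re w *\<^sub>R b + Im w *\<^sub>R a)) (at z)"
    unfolding c_def by blast
qed


subsection \<open>The extension\<close>

locale two_slices =
  fixes I1 I2 :: quat and U1 U2 :: "quat set" and f :: "quat \<Rightarrow> quat"
  assumes I1: "I1 \<in> imag_sphere" and I2: "I2 \<in> imag_sphere" and I12: "I1 \<noteq> I2"
    and U1_open: "openin (top_of_set (slice_plane I1)) U1"
    and U2_open: "openin (top_of_set (slice_plane I2)) U2"
    and f_hol1: "left_holomorphic_on I1 f U1"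
    and f_hol2: "left_holomorphic_on I2 f U2"
begin

definition E1 :: "complex set" where "E1 = slice_point I1 -` U1"
definition E2 :: "complex set" where "E2 = slice_point I2 -` U2"

text \<open>The coefficient of the unit in the linear system for the values of \<open>f\<close> over
  \<open>z\<close> in the two slices. The inverse stands on the left because units multiply from the
  left.\<close>

definition stem2 :: "complex \<Rightarrow> quat" where
  "stem2 z = inverse (I1 - I2) * (f (slice_point I1 z) - f (slice_point I2 z))"

definition stem1 :: "complex \<Rightarrow> quat" where
  "stem1 z = f (slice_point I1 z) - I1 * stem2 z"

text \<open>At real \<open>q\<close> the imaginary unit is not determined by \<open>q\<close>; there \<open>sgn\<close> returns \<open>0\<close>, which
  is harmless because \<open>stem2\<close> vanishes on the real axis.\<close>

definition extension :: "quat \<Rightarrow> quat" where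
  "extension q =
     (let v = q - of_real (qRe q); z = Complex (qRe q) (norm v)
      in if z \<in> E1 \<inter> E2 then stem1 z + sgn v * stem2 z else f q)"

abbreviation "U_plus \<equiv> Us_plus I1 I2 U1 U2"
abbreviation "U_plus_Delta \<equiv> Us_plus_Delta I1 I2 U1 U2"

lemma open_E1: "open E1"
proof -
  have "U1 \<inter> slice_plane I1 = U1" using openin_imp_subset[OF U1_open] by blast
  then show ?thesis using U1_open openin_slice_plane_iff[OF I1, of U1] by (simp add: E1_def)
qed

lemma open_E2: "open E2"
proof -
  have "U2 \<inter> slice_plane I2 = U2" using openin_imp_subset[OF U2_open] by blast
  then show ?thesis using U2_open openin_slice_plane_iff[OF I2, of U2] by (simp add: E2_def)
qed

lemma hol1: "slice_holomorphic I1 (f \<circ> slice_point I1) E1"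
  using left_holomorphic_on_iff[OF I1 open_E1[unfolded E1_def], of f] f_hol1 unfolding E1_def by simp

lemma hol2: "slice_holomorphic I2 (f \<circ> slice_point I2) E2"
  using left_holomorphic_on_iff[OF I2 open_E2[unfolded E2_def], of f] f_hol2 unfolding E2_def by simp

lemma stem_pair: "stem_pair stem1 stem2 (E1 \<inter> E2)"
  using stem_pair_from_two_slices[OF I1 I2 I12 slice_holomorphic_subset[OF hol1] slice_holomorphic_subset[OF hol2]]
  unfolding stem1_def[abs_def] stem2_def[abs_def] by simp

lemma stem2_real: "Im z = 0 \<Longrightarrow> stem2 z = 0"
  by (simp add: stem2_def slice_point_def)

lemma stem_at_I1: "stem1 z + I1 * stem2 z = f (slice_point I1 z)"
  by (simp add: stem1_def)

lemma stem_at_I2: "stem1 z + I2 * stem2 z = f (slice_point I2 z)"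
proof -
  have "(I1 - I2) * inverse (I1 - I2) = 1" using I12 by (simp add: right_inverse)
  then have "(I1 - I2) * stem2 z = f (slice_point I1 z) - f (slice_point I2 z)"
    unfolding stem2_def mult.assoc[symmetric] by simp
  then show ?thesis by (simp add: stem1_def left_diff_distrib algebra_simps)
qed

lemma extension_slice_point:
  assumes L: "L \<in> imag_sphere" and "Im z \<ge> 0"
  shows "extension (slice_point L z) =
    (if z \<in> E1 \<inter> E2 then stem1 z + L * stem2 z else f (slice_point L z))"
proof -
  have L1: "norm L = 1" using L by (simp add: imag_sphere_iff)
  have n: "norm (Im z *\<^sub>R L) = Im z" using L1 assms(2) by simp
  \<comment> \<open>For \<open>Im z > 0\<close> the sign recovers \<open>L\<close>; at a real point
    both products are 0.\<close>
  have s: "sgn (Im z *\<^sub>R L) * stem2 z = L * stem2 z"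
  proof (cases "Im z = 0")
    case False
    then have "sgn (Im z *\<^sub>R L) = L" using assms(2) L1 by (simp add: sgn_div_norm)
    then show ?thesis by simp
  qed (simp add: stem2_real)
  show ?thesis
    unfolding extension_def Let_def qRe_slice_point[OF L]
      Im_part_slice_point[OF L, unfolded qRe_slice_point[OF L]] n complex_surj s
    by (rule refl)
qed

section \<open>The domains in upper half-plane coordinates, and the values of the extension\<close>

lemma slice_point_mem_U_plus:
  assumes L: "L \<in> imag_sphere" and z: "Im z \<ge> 0"
  shows "slice_point L z \<in> U_plus \<longleftrightarrow>
    (Im z > 0 \<and> (L = I1 \<and> z \<in> E1 \<or> L = I2 \<and> z \<in> E2)) \<or> (Im z = 0 \<and> z \<in> E1 \<inter> E2)"
proof -
  have half: "slice_point L z \<in> upper_half_slice I \<longleftrightarrow> Im z > 0 \<and> L = I" if "I \<in> imag_sphere" for I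
  proof
    assume "slice_point L z \<in> upper_half_slice I"
    then obtain x y where xy: "y > 0" "slice_point L z = of_real x + of_real y * I"
      unfolding upper_half_slice_def by blast
    then have eq: "slice_point L z = slice_point I (Complex x y)" by (simp add: slice_point_def)
    have "z = Complex x y \<and> (Im z = 0 \<or> L = I)"
      by (rule slice_point_eq_upper_iff[THEN iffD1, OF L that z _ eq]) (use xy(1) in simp)
    then show "Im z > 0 \<and> L = I" using xy(1) by auto
  next
    assume "Im z > 0 \<and> L = I"
    then show "slice_point L z \<in> upper_half_slice I"
      unfolding upper_half_slice_def slice_point_def by blast
  qed
  have real: "slice_point L z \<in> \<real> \<longleftrightarrow> Im z = 0"
  proof
    assume "slice_point L z \<in> \<real>"
    then obtain x where "slice_point L z = slice_point L (of_real x)"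
      by (auto elim: Reals_cases)
    then show "Im z = 0"
      using slice_point_eq_upper_iff[OF L L z, of "of_real x"] by simp
  qed (simp add: slice_point_def)
  have "slice_point L z = slice_point I z" if "Im z = 0" for I
    using that by (simp add: slice_point_def)
  then show ?thesis
    using half[OF I1] half[OF I2] real unfolding Us_plus_def E1_def E2_def Un_iff Int_iff vimage_eq by metis
qed

text \<open>With nonnegative imaginary part the coordinate \<open>z\<close> is determined by the
  point, even at real points, where the unit is not.\<close>

lemma slice_point_mem_U_Delta:
  assumes L: "L \<in> imag_sphere" and z: "Im z \<ge> 0"
  shows "slice_point L z \<in> Us_Delta I1 I2 U1 U2 \<longleftrightarrow> z \<in> E1 \<inter> E2"
proof
  assume "slice_point L z \<in> Us_Delta I1 I2 U1 U2"
  then obtain x y M where M: "M \<in> imag_sphere" "y \<ge> 0" "of_real x + of_real y * I1 \<in> U1"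
      "of_real x + of_real y * I2 \<in> U2" "slice_point L z = of_real x + of_real y * M"
    unfolding Us_Delta_def by blast
  then have "slice_point L z = slice_point M (Complex x y)" by (simp add: slice_point_def)
  then have "z = Complex x y"
    using slice_point_eq_upper_iff[OF L M(1) z, of "Complex x y"] M(2) by simp
  then show "z \<in> E1 \<inter> E2" using M by (simp add: E1_def E2_def slice_point_def)
next
  assume "z \<in> E1 \<inter> E2"
  then show "slice_point L z \<in> Us_Delta I1 I2 U1 U2"
    unfolding Us_Delta_def E1_def E2_def slice_point_def using L z by blast
qed

lemma slice_point_mem_U_plus_Delta:
  assumes L: "L \<in> imag_sphere" and z: "Im z \<ge> 0"
  shows "slice_point L z \<in> U_plus_Delta \<longleftrightarrow>
    z \<in> E1 \<inter> E2 \<or> (Im z > 0 \<and> (L = I1 \<and> z \<in> E1 \<or> L = I2 \<and> z \<in> E2))"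
  unfolding Us_plus_Delta_def Un_iff slice_point_mem_U_plus[OF assms] slice_point_mem_U_Delta[OF assms] by blast

text \<open>Both branches of the extension give \<open>f\<close> here: one because the stem
  functions solve the linear system, the other by definition.\<close>

lemma extension_at_I1: "Im z \<ge> 0 \<Longrightarrow> extension (slice_point I1 z) = f (slice_point I1 z)"
  by (simp add: extension_slice_point I1 stem_at_I1)

lemma extension_at_I2: "Im z \<ge> 0 \<Longrightarrow> extension (slice_point I2 z) = f (slice_point I2 z)"
  by (simp add: extension_slice_point I2 stem_at_I2)

lemma extension_eq:
  assumes "q \<in> U_plus"
  shows "extension q = f q"
proof -
  obtain L z where L: "L \<in> imag_sphere" "Im z \<ge> 0" "q = slice_point L z"
    by (rule slice_point_surj)
  then consider "L = I1" | "L = I2" | "Im z = 0"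
    using assms slice_point_mem_U_plus[OF L(1,2)] by auto
  then show ?thesis
  proof cases
    case 3
    then have "q = slice_point I1 z" using L(3) by (simp add: slice_point_def)
    then show ?thesis using extension_at_I1 L(2) by simp
  qed (use extension_at_I1 extension_at_I2 L in simp_all)
qed

text \<open>Over a \<open>z\<close> outside \<open>E1 \<inter> E2\<close> the domain contains at
  most one point with nonnegative imaginary coordinate, so the value of \<open>f\<close> there with
  second component 0 is an admissible stem.\<close>

lemma slice_function_extension: "slice_function_on extension U_plus_Delta"
proof -
  define F :: "real \<times> real \<Rightarrow> quat ^ 2" where
    "F p = (let z = Complex (fst p) (snd p) in
       if z \<in> E1 \<inter> E2 then vector [stem1 z, stem2 z]
       else if z \<in> E1 then vector [f (slice_point I1 z), 0]
       else vector [f (slice_point I2 z), 0])" for p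
  have "extension (of_real x + of_real y * L) = F (x, y) $ 1 + L * F (x, y) $ 2"
    if L: "L \<in> imag_sphere" and y: "y \<ge> 0" and q: "of_real x + of_real y * L \<in> U_plus_Delta" for x y L
  proof -
    define z where "z = Complex x y"
    have z: "of_real x + of_real y * L = slice_point L z" "Im z \<ge> 0"
      using y by (simp_all add: z_def slice_point_def)
    have F: "F (x, y) = (if z \<in> E1 \<inter> E2 then vector [stem1 z, stem2 z]
       else if z \<in> E1 then vector [f (slice_point I1 z), 0]
       else vector [f (slice_point I2 z), 0])"
      by (simp add: F_def z_def Let_def)
    have "z \<in> E1 \<inter> E2 \<or> (z \<in> E1 \<and> L = I1 \<or> z \<in> E2 \<and> L = I2)"
      using q slice_point_mem_U_plus_Delta[OF L z(2)] unfolding z(1) by blast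
    then show ?thesis
      unfolding z(1) extension_slice_point[OF L z(2)] F by (auto simp: vector_2)
  qed
  then show ?thesis unfolding slice_function_on_def by blast
qed

section \<open>Slice regularity of the extension\<close>

lemma extension_local_upper:
  assumes L: "L \<in> imag_sphere" and z: "Im z \<ge> 0" and q: "slice_point L z \<in> U_plus_Delta"
  shows "\<exists>N l. open N \<and> z \<in> N \<and> slice_point L ` N \<subseteq> U_plus_Delta \<and> slice_holomorphic L l N \<and>
    (\<forall>w\<in>N. extension (slice_point L w) = l w)"
proof -
  let ?H = "{w. Im w > 0}"
  have H: "open ?H" by (simp add: open_halfspace_Im_gt)
  from q consider "z \<in> E1 \<inter> E2" "Im z > 0" | "Im z > 0" "L = I1" "z \<in> E1" | "Im z > 0" "L = I2" "z \<in> E2"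
    | "z \<in> E1 \<inter> E2" "Im z = 0"
    using z unfolding slice_point_mem_U_plus_Delta[OF L z] by fastforce
  then show ?thesis
  proof cases
    case 1
    have "slice_point L ` (E1 \<inter> E2 \<inter> ?H) \<subseteq> U_plus_Delta"
      using slice_point_mem_U_plus_Delta[OF L] by (auto simp: less_imp_le)
    moreover have "slice_holomorphic L (\<lambda>z. stem1 z + L * stem2 z) (E1 \<inter> E2 \<inter> ?H)"
      by (rule slice_holomorphic_subset[OF stem_pair_slice_holomorphic[OF L stem_pair]]) blast
    ultimately show ?thesis
      using 1 open_E1 open_E2 H extension_slice_point[OF L]
      by (intro exI[of _ "E1 \<inter> E2 \<inter> ?H"] exI[of _ "\<lambda>z. stem1 z + L * stem2 z"]) (simp add: open_Int)
  next
    case 2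
    have "slice_point L ` (E1 \<inter> ?H) \<subseteq> U_plus_Delta"
      using slice_point_mem_U_plus_Delta[OF L] 2 by (auto simp: less_imp_le)
    moreover have "slice_holomorphic L (f \<circ> slice_point I1) (E1 \<inter> ?H)"
      unfolding \<open>L = I1\<close> by (rule slice_holomorphic_subset[OF hol1]) blast
    ultimately show ?thesis
      using 2 open_E1 H extension_at_I1
      by (intro exI[of _ "E1 \<inter> ?H"] exI[of _ "f \<circ> slice_point I1"]) (simp add: open_Int)
  next
    case 3
    have "slice_point L ` (E2 \<inter> ?H) \<subseteq> U_plus_Delta"
      using slice_point_mem_U_plus_Delta[OF L] 3 by (auto simp: less_imp_le)
    moreover have "slice_holomorphic L (f \<circ> slice_point I2) (E2 \<inter> ?H)"
      unfolding \<open>L = I2\<close> by (rule slice_holomorphic_subset[OF hol2]) blast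
    ultimately show ?thesis
      using 3 open_E2 H extension_at_I2
      by (intro exI[of _ "E2 \<inter> ?H"] exI[of _ "f \<circ> slice_point I2"]) (simp add: open_Int)
  next
    case 4
    obtain x where x: "z = of_real x" using \<open>Im z = 0\<close> by (metis complex_is_Real_iff Reals_cases)
    obtain r where r: "r > 0" "ball z r \<subseteq> E1 \<inter> E2"
      using open_Int[OF open_E1 open_E2] 4(1) by (rule openE)
    \<comment> \<open>A ball around a real point crosses the axis. Its lower points are upper points
      of the slice of \<open>- L\<close>, where the extension has the conjugated formula; reflection
      identifies this with the formula for \<open>L\<close>.\<close>
    have ext: "slice_point L w \<in> U_plus_Delta \<and> extension (slice_point L w) = stem1 w + L * stem2 w"
      if w: "w \<in> ball z r" for w
    proof (cases "Im w \<ge> 0")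
      case True
      with w r(2) show ?thesis
        using slice_point_mem_U_plus_Delta[OF L True] extension_slice_point[OF L True] by auto
    next
      case False
      then have Im: "Im (cnj w) \<ge> 0" by simp
      have L': "- L \<in> imag_sphere" using L by simp
      have "dist z (cnj w) = dist z w"
        unfolding x by (metis complex_cnj_complex_of_real complex_cnj_diff complex_mod_cnj dist_norm)
      then have w': "cnj w \<in> E1 \<inter> E2" using w r(2) by auto
      have sp: "slice_point L w = slice_point (- L) (cnj w)" by (simp add: slice_point_cnj)
      have "stem1 (cnj w) - L * stem2 (cnj w) = stem1 w + L * stem2 w"
      proof (rule stem_pair_reflection[OF L])
        show "stem_pair stem1 stem2 (ball (of_real x) r)"
          using stem_pair r(2) unfolding stem_pair_def x by blast
        show "w \<in> ball (of_real x) r" using w x by simp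
      qed (simp add: stem2_real)
      then show ?thesis
        unfolding sp slice_point_mem_U_plus_Delta[OF L' Im] extension_slice_point[OF L' Im]
        using w' by simp
    qed
    have "slice_holomorphic L (\<lambda>z. stem1 z + L * stem2 z) (ball z r)"
      by (rule slice_holomorphic_subset[OF stem_pair_slice_holomorphic[OF L stem_pair] r(2)])
    then show ?thesis
      using ext r(1)
      by (intro exI[of _ "ball z r"] exI[of _ "\<lambda>z. stem1 z + L * stem2 z"]) auto
  qed
qed

text \<open>The lower half of the slice of \<open>L\<close> is the upper half of the slice of
  \<open>- L\<close>, so conjugation transports the local formula.\<close>

lemma extension_local:
  assumes L: "L \<in> imag_sphere" and q: "slice_point L z \<in> U_plus_Delta"
  shows "\<exists>N l. open N \<and> z \<in> N \<and> slice_point L ` N \<subseteq> U_plus_Delta \<and> slice_holomorphic L l N \<and>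
    (\<forall>w\<in>N. extension (slice_point L w) = l w)"
proof (cases "Im z \<ge> 0")
  case True
  then show ?thesis using extension_local_upper L q by blast
next
  case False
  have sp: "slice_point (- L) (cnj w) = slice_point L w" for w
    by (simp add: slice_point_cnj)
  have "Im (cnj z) \<ge> 0" "- L \<in> imag_sphere" "slice_point (- L) (cnj z) \<in> U_plus_Delta"
    using False L q sp by simp_all
  from extension_local_upper[OF this(2,1,3)] obtain N l where N: "open N" "cnj z \<in> N" "slice_point (- L) ` N \<subseteq> U_plus_Delta"
      "slice_holomorphic (- L) l N" "\<forall>w\<in>N. extension (slice_point (- L) w) = l w"
    by blast
  have "open (cnj -` N)" using N(1) by (intro open_vimage continuous_intros)
  moreover have "z \<in> cnj -` N" using N(2) by simp
  moreover have "slice_point L ` (cnj -` N) \<subseteq> U_plus_Delta"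
    using N(3) sp by (metis (no_types, lifting) image_subset_iff vimageE)
  moreover have "slice_holomorphic L (l \<circ> cnj) (cnj -` N)"
    using slice_holomorphic_cnj[OF N(4)] by simp
  moreover have "\<forall>w\<in>cnj -` N. extension (slice_point L w) = (l \<circ> cnj) w"
    using N(5) sp by (metis comp_apply vimageE)
  ultimately show ?thesis by blast
qed

lemma slice_regular_extension: "slice_regular_on extension U_plus_Delta"
  unfolding slice_regular_on_iff
proof (intro ballI conjI)
  fix L assume L: "L \<in> imag_sphere"
  show "open (slice_point L -` U_plus_Delta)"
  proof (rule open_subopen[THEN iffD2], rule ballI)
    fix z assume "z \<in> slice_point L -` U_plus_Delta"
    then have "slice_point L z \<in> U_plus_Delta" by simp
    from extension_local[OF L this]
    show "\<exists>T. open T \<and> z \<in> T \<and> T \<subseteq> slice_point L -` U_plus_Delta"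
      unfolding image_subset_iff_subset_vimage by blast
  qed
  show "slice_holomorphic L (extension \<circ> slice_point L) (slice_point L -` U_plus_Delta)"
  proof (rule slice_holomorphic_local)
    fix z assume "z \<in> slice_point L -` U_plus_Delta"
    then have "slice_point L z \<in> U_plus_Delta" by simp
    from extension_local[OF L this]
    show "\<exists>N l. open N \<and> z \<in> N \<and> slice_holomorphic L l N \<and> (\<forall>w\<in>N. (extension \<circ> slice_point L) w = l w)"
      unfolding comp_apply by blast
  qed
qed

text \<open>The difference \<open>h\<close> vanishes on \<open>W \<inter> U_plus\<close>. By the
  identity principle it remains to find one point at which its zeros accumulate within a
  slice.\<close>

lemma extension_unique:
  assumes W: "st_domain W" and sub: "W \<subseteq> U_plus_Delta" and ne: "W \<inter> U_plus \<noteq> {}"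
    and g: "slice_regular_on g W" and gf: "\<And>q. q \<in> W \<inter> U_plus \<Longrightarrow> g q = f q" and q: "q \<in> W"
  shows "g q = extension q"
proof -
  define h where "h = (\<lambda>q. g q - extension q)"
  have h_hol: "slice_holomorphic L (h \<circ> slice_point L) (slice_point L -` W)" if L: "L \<in> imag_sphere" for L
  proof -
    have "slice_holomorphic L (extension \<circ> slice_point L) (slice_point L -` U_plus_Delta)"
      using slice_regular_extension L by (simp add: slice_regular_on_iff)
    then have "slice_holomorphic L (extension \<circ> slice_point L) (slice_point L -` W)"
      by (rule slice_holomorphic_subset) (use sub in blast)
    moreover have "slice_holomorphic L (g \<circ> slice_point L) (slice_point L -` W)"
      using g L by (simp add: slice_regular_on_iff)
    ultimately have "slice_holomorphic L (\<lambda>z. (g \<circ> slice_point L) z - (extension \<circ> slice_point L) z)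
        (slice_point L -` W)"
      by (rule slice_holomorphic_diff[rotated])
    then show ?thesis by (simp add: h_def o_def)
  qed
  have h0: "h p = 0" if "p \<in> W" "p \<in> U_plus" for p
    using gf extension_eq that by (simp add: h_def)
  have W_open: "open (slice_point L -` W)" if "L \<in> imag_sphere" for L
    using W that by (simp add: st_domain_def slice_open_iff)
  \<comment> \<open>Off the real axis \<open>U_plus\<close> contains a neighbourhood within the
    slice, so \<open>h\<close> vanishes on an open set around \<open>z\<close>.\<close>
  have upper: "h q = 0" if J: "J \<in> imag_sphere" "slice_point J z \<in> W"
    and N: "open N" "z \<in> N" "\<And>w. w \<in> N \<Longrightarrow> Im w > 0 \<Longrightarrow> slice_point J w \<in> U_plus" and z: "Im z > 0" for J z N
  proof (rule slice_identity_principle[OF W h_hol J _ q])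
    let ?T = "slice_point J -` W \<inter> (N \<inter> {w. Im w > 0})"
    have "open ?T" by (intro open_Int W_open J N open_halfspace_Im_gt)
    then have "interior ?T = ?T" by (rule interior_open)
    moreover have "z \<in> ?T" using J(2) N(2) z by simp
    ultimately have "z islimpt ?T" using interior_limit_point by metis
    then show "z islimpt {z. h (slice_point J z) = 0}"
      by (rule islimpt_subset) (use h0 N(3) in auto)
  qed
  obtain p where p: "p \<in> W" "p \<in> U_plus" using ne by blast
  obtain L z where Lz: "L \<in> imag_sphere" "Im z \<ge> 0" "p = slice_point L z"
    by (rule slice_point_surj)
  from p(2) consider "Im z > 0" "L = I1" "z \<in> E1" | "Im z > 0" "L = I2" "z \<in> E2" | "Im z = 0" "z \<in> E1 \<inter> E2"
    unfolding Lz(3) slice_point_mem_U_plus[OF Lz(1,2)] by blast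
  then have "h q = 0"
  proof cases
    case 1
    show ?thesis
      using Lz p(1) 1 by (intro upper[of I1 z E1]) (simp_all add: I1 open_E1 slice_point_mem_U_plus)
  next
    case 2
    show ?thesis
      using Lz p(1) 2 by (intro upper[of I2 z E2]) (simp_all add: I2 open_E2 slice_point_mem_U_plus)
  next
    case 3
    obtain x where x: "z = of_real x" using \<open>Im z = 0\<close> by (metis complex_is_Real_iff Reals_cases)
    have "open (slice_point L -` W \<inter> (E1 \<inter> E2))"
      by (intro open_Int W_open Lz open_E1 open_E2)
    moreover have "z \<in> slice_point L -` W \<inter> (E1 \<inter> E2)"
      using 3 p(1) Lz(3) by simp
    ultimately obtain r where r: "r > 0" "ball z r \<subseteq> slice_point L -` W \<inter> (E1 \<inter> E2)"
      by (rule openE)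
    \<comment> \<open>The slice of \<open>L\<close> need not meet \<open>U_plus\<close> off the
      axis, but the real diameter of the ball lies in \<open>U_plus\<close>.\<close>
    have "of_real ` ball x r \<subseteq> {z. h (slice_point L z) = 0}"
    proof
      fix w :: complex assume "w \<in> of_real ` ball x r"
      then obtain t where t: "t \<in> ball x r" "w = of_real t" by blast
      then have "w \<in> ball z r" by (simp add: x dist_of_real)
      with r(2) have "slice_point L w \<in> W" "w \<in> E1 \<inter> E2" by blast+
      moreover have "slice_point L w \<in> U_plus"
        using slice_point_mem_U_plus[OF Lz(1), of w] t(2) \<open>w \<in> E1 \<inter> E2\<close> by simp
      ultimately show "w \<in> {z. h (slice_point L z) = 0}" using h0 by blast
    qed
    then have "z islimpt {z. h (slice_point L z) = 0}"
      using islimpt_real_points[OF r(1), of x] unfolding x by (metis islimpt_subset)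
    with W h_hol Lz(1) p(1)[unfolded Lz(3)] show ?thesis
      using q by (rule slice_identity_principle)
  qed
  then show ?thesis by (simp add: h_def)
qed

end

section \<open>Restriction to subdomains and conclusion\<close>

lemma slice_function_on_subset: "slice_function_on f A \<Longrightarrow> B \<subseteq> A \<Longrightarrow> slice_function_on f B"
  unfolding slice_function_on_def by (meson subsetD)

lemma slice_regular_on_subset:
  "slice_regular_on f A \<Longrightarrow> B \<subseteq> A \<Longrightarrow> slice_open B \<Longrightarrow> slice_regular_on f B"
  unfolding slice_regular_on_iff slice_open_iff
  by (auto intro: slice_holomorphic_subset)

theorem theorem6p2:
  fixes I1 I2 :: quat and U1 U2 :: "quat set" and f :: "quat \<Rightarrow> quat"
  assumes "I1 \<in> imag_sphere" and "I2 \<in> imag_sphere" and "I1 \<noteq> I2"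
    and "openin (top_of_set (slice_plane I1)) U1"
    and "openin (top_of_set (slice_plane I2)) U2"
    and "left_holomorphic_on I1 f U1"
    and "left_holomorphic_on I2 f U2"
  shows "\<exists>ft :: quat \<Rightarrow> quat.
           slice_regular_on ft (Us_plus_Delta I1 I2 U1 U2) \<and>
           (\<forall>q\<in>Us_plus I1 I2 U1 U2. ft q = f q) \<and>
           (\<forall>W. st_domain W \<and> W \<subseteq> Us_plus_Delta I1 I2 U1 U2 \<and> W \<inter> Us_plus I1 I2 U1 U2 \<noteq> {} \<longrightarrow>
              slice_function_on ft W \<and>
              slice_regular_on ft W \<and>
              (\<forall>q\<in>W \<inter> Us_plus I1 I2 U1 U2. ft q = f q) \<and>
              (\<forall>g. slice_regular_on g W \<and> (\<forall>q\<in>W \<inter> Us_plus I1 I2 U1 U2. g q = f q) \<longrightarrow>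
                   (\<forall>q\<in>W. g q = ft q)))"
proof -
  interpret two_slices I1 I2 U1 U2 f
    using assms by unfold_locales
  show ?thesis
  \<comment> \<open>The witness does not depend on \<open>W\<close>; being a slice function and
    slice regularity are inherited from the whole domain.\<close>
  proof (intro exI[of _ extension] conjI allI impI ballI)
    show "slice_regular_on extension U_plus_Delta"
      by (rule slice_regular_extension)
    show "extension q = f q" if "q \<in> U_plus" for q
      using that by (rule extension_eq)
    fix W assume W: "st_domain W \<and> W \<subseteq> U_plus_Delta \<and> W \<inter> U_plus \<noteq> {}"
    show "slice_function_on extension W"
      using slice_function_on_subset[OF slice_function_extension] W by blast
    show "slice_regular_on extension W"
      using slice_regular_on_subset[OF slice_regular_extension] W unfolding st_domain_def by blast
    show "extension q = f q" if "q \<in> W \<inter> U_plus" for q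
      using that by (intro extension_eq) blast
    show "g q = extension q" if "slice_regular_on g W \<and> (\<forall>q\<in>W \<inter> U_plus. g q = f q)" "q \<in> W" for g q
      using extension_unique W that by blast
  qed
qed

end
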